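(* Let $\mathcal R$ and $\mathcal R'$ be two rings. Suppose that $\mathcal R$ is a $2$-torsion free ring containing a nontrivial idempotent $e_1$ and that, with $e_2=1-e_1$, the following hold: (i) for all $a\in\mathcal R$ and all $i,j,k\in\{1,2\}$, if $e_iae_j\mathcal R e_k=\{0\}$ or $e_k\mathcal R e_iae_j=\{0\}$, then $e_iae_j=0$; (ii) if $a\in\mathcal R$ satisfies $e_2ae_2be_2+e_2be_2ae_2=0$ for every $b\in\mathcal R$, then $e_2ae_2=0$. Suppose that $M\colon\mathcal R\to\mathcal R'$ and $M^*\colon\mathcal R'\to\mathcal R$ are surjective maps (not assumed additive) such that $M(aM^*(x)+M^*(x)a)=M(a)x+xM(a)$ and $M^*(M(a)x+xM(a))=aM^*(x)+M^*(x)a$ for all $a\in\mathcal R$, $x\in\mathcal R'$. Then both $M$ and $M^*$ are additive.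
   Context: Rings are associative and need not have an identity element. A ring is $2$-torsion free if $2a=0$ implies $a=0$. A nontrivial idempotent is an element $e_1$ with $e_1^2=e_1$, $e_1\neq 0$, and $e_1$ not an identity element of $\mathcal R$. The symbol $e_2=1-e_1$ is formal when $\mathcal R$ has no identity: $e_2a:=a-e_1a$ and $ae_2:=a-ae_1$ for $a\in\mathcal R$. *)

theory Defs
  imports Complex_Main
begin

text \<open>
  Type class \<open>ring\<close> is the class of associative rings that need not be commutative and
  need not have an identity element.
\<close>

definition two_torsion_free :: "'a::ring itself \<Rightarrow> bool" where
  "two_torsion_free _ \<longleftrightarrow> (\<forall>a::'a. a + a = 0 \<longrightarrow> a = 0)"

definition nontrivial_idempotent :: "'a::ring \<Rightarrow> bool" where
  "nontrivial_idempotent e \<longleftrightarrow>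
     e * e = e \<and> e \<noteq> 0 \<and> \<not> (\<forall>a. e * a = a \<and> a * e = a)"

text \<open>
  \<open>lmul e i a\<close> and \<open>rmul e a i\<close> are \<open>e\<^sub>i a\<close> and \<open>a e\<^sub>i\<close>, where \<open>e\<^sub>1 = e\<close> and
  \<open>e\<^sub>2 = 1 - e\<close> is formal, since the ring may lack an identity.
  Only the indices 1 and 2 are meaningful.
\<close>

definition lmul :: "'a::ring \<Rightarrow> nat \<Rightarrow> 'a \<Rightarrow> 'a" where
  "lmul e i a = (if i = 1 then e * a else a - e * a)"

definition rmul :: "'a::ring \<Rightarrow> 'a \<Rightarrow> nat \<Rightarrow> 'a" where
  "rmul e a i = (if i = 1 then a * e else a - a * e)"

text \<open>
  \<open>peirce e i a j\<close> is \<open>e\<^sub>i a e\<^sub>j\<close>. The bracketing is immaterial, by the lemmas below.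
\<close>

definition peirce :: "'a::ring \<Rightarrow> nat \<Rightarrow> 'a \<Rightarrow> nat \<Rightarrow> 'a" where
  "peirce e i a j = rmul e (lmul e i a) j"

lemma peirce_assoc: "peirce e i a j = lmul e i (rmul e a j)"
  by (simp add: peirce_def lmul_def rmul_def algebra_simps)

lemma lmul_mult: "lmul e i (a * b) = lmul e i a * b"
  by (simp add: lmul_def algebra_simps)

lemma rmul_mult: "rmul e (a * b) i = a * rmul e b i"
  by (simp add: rmul_def algebra_simps)

lemma rmul_lmul_middle: "rmul e a i * b = a * lmul e i b"
  by (simp add: lmul_def rmul_def algebra_simps)

end

theory Submission
  imports Defs
begin

text \<open>
  Put \<open>a \<odot> b = ab + ba\<close>. Both maps turn out to be bijective, so with \<open>P = M\<close> and
  \<open>Q = M\<^sup>*\<^sup>-\<^sup>1\<close> the two identities become the symmetric condition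
  \<open>P (a \<odot> b) = Q (a \<odot> b) = P a \<odot> Q b\<close>. If \<open>P c = P a + P b\<close>, then
  \<open>P (c \<odot> s) = P (a \<odot> s) + P (b \<odot> s)\<close> for every \<open>s\<close>; so whenever the right-hand side is
  \<open>P ((a + b) \<odot> s)\<close> for all \<open>s\<close> in a set with trivial Jordan annihilator, \<open>c = a + b\<close>.
  Additivity on sums of Peirce components follows by applying this principle repeatedly, with
  \<open>s\<close> ranging over \<open>R\<^sub>2\<^sub>2 \<union> R\<^sub>1\<^sub>2\<close>, \<open>{e} \<union> R\<^sub>1\<^sub>2\<close> or their mirror images.
\<close>

declare One_nat_def [simp del]

section \<open>The Jordan product and the Peirce spaces\<close>

definition jordan :: "'a::ring \<Rightarrow> 'a \<Rightarrow> 'a"  (infixl \<open>\<odot>\<close> 70) where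
  "a \<odot> b = a * b + b * a"

lemma jordan_commute: "a \<odot> b = b \<odot> a"
  by (simp add: jordan_def add.commute)

lemma jordan_zero [simp]: "0 \<odot> a = 0" "a \<odot> 0 = 0"
  by (simp_all add: jordan_def)

lemma jordan_add_left: "(a + b) \<odot> c = a \<odot> c + b \<odot> c"
  by (simp add: jordan_def algebra_simps)

lemma jordan_add_right: "a \<odot> (b + c) = a \<odot> b + a \<odot> c"
  by (simp add: jordan_def algebra_simps)

lemma jordan_diff_left: "(a - b) \<odot> c = a \<odot> c - b \<odot> c"
  by (simp add: jordan_def algebra_simps)

text \<open>For idempotent \<open>e\<close> this is the set of all \<open>peirce e i a j\<close>;
  the fixed-point form turns membership into two equations and does not mention
  \<open>a\<close>.\<close>

definition peirce_space :: "'a::ring \<Rightarrow> nat \<Rightarrow> nat \<Rightarrow> 'a set" where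
  "peirce_space e i j = {x. lmul e i x = x \<and> rmul e x j = x}"

lemma peirce_space_iff:
  "x \<in> peirce_space e 1 1 \<longleftrightarrow> e * x = x \<and> x * e = x"
  "x \<in> peirce_space e 1 2 \<longleftrightarrow> e * x = x \<and> x * e = 0"
  "x \<in> peirce_space e 2 1 \<longleftrightarrow> e * x = 0 \<and> x * e = x"
  "x \<in> peirce_space e 2 2 \<longleftrightarrow> e * x = 0 \<and> x * e = 0"
  by (auto simp: peirce_space_def lmul_def rmul_def)

lemma peirce_space_add:
  "x \<in> peirce_space e i j \<Longrightarrow> y \<in> peirce_space e i j \<Longrightarrow> x + y \<in> peirce_space e i j"
  unfolding peirce_space_def lmul_def rmul_def
  by (auto simp: algebra_simps split: if_splits)

lemma peirce_space_mult:
  "x \<in> peirce_space e i j \<Longrightarrow> y \<in> peirce_space e k l \<Longrightarrow> x * y \<in> peirce_space e i l"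
  by (simp add: peirce_space_def lmul_mult rmul_mult)

text \<open>One of the two factors absorbs \<open>e\<close> on the inner side and the other is
  killed by it. The index condition has this form because every index other than 1 acts as
  2.\<close>

lemma peirce_space_mult_eq_0:
  assumes "x \<in> peirce_space e i j" "y \<in> peirce_space e k l" "(j = 1) \<noteq> (k = 1)"
  shows "x * y = 0"
proof -
  have "x * y = rmul e x j * lmul e k y"
    using assms by (simp add: peirce_space_def)
  also have "\<dots> = 0"
  proof (cases "j = 1")
    case True
    then have "lmul e k y = y" "e * y = 0"
      using assms by (auto simp: peirce_space_def lmul_def)
    then show ?thesis
      using True by (simp add: rmul_def mult.assoc)
  next
    case False
    then have "rmul e x j = x" "x * e = 0" "lmul e k y = e * y"
      using assms by (auto simp: peirce_space_def lmul_def rmul_def)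
    then show ?thesis
      by (simp flip: mult.assoc)
  qed
  finally show ?thesis .
qed

lemma peirce_mem_peirce_space:
  assumes "e * e = e"
  shows "peirce e i a j \<in> peirce_space e i j"
proof -
  have "e * (e * x) = e * x" for x
    using assms by (simp flip: mult.assoc)
  then show ?thesis
    using assms by (simp add: peirce_space_def peirce_def lmul_def rmul_def algebra_simps)
qed

section \<open>Sets with trivial Jordan annihilator\<close>

locale peirce_ring =
  fixes e :: "'r::ring"
  assumes torsion_free: "a + a = 0 \<Longrightarrow> a = (0::'r)"
    and idem: "e * e = e"
    and peirce_right: "\<lbrakk>i \<in> {1,2}; j \<in> {1,2}; k \<in> {1,2}; a \<in> peirce_space e i j;
      \<And>r. rmul e (a * r) k = 0\<rbrakk> \<Longrightarrow> a = 0"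
    and peirce_left: "\<lbrakk>i \<in> {1,2}; j \<in> {1,2}; k \<in> {1,2}; a \<in> peirce_space e i j;
      \<And>r. lmul e k (r * a) = 0\<rbrakk> \<Longrightarrow> a = 0"
    and jordan_22: "\<lbrakk>a \<in> peirce_space e 2 2; \<And>b. b \<in> peirce_space e 2 2 \<Longrightarrow> a \<odot> b = 0\<rbrakk>
      \<Longrightarrow> a = 0"
begin

abbreviation R :: "nat \<Rightarrow> nat \<Rightarrow> 'r set" where
  "R \<equiv> peirce_space e"

lemma idem_left: "e * (e * x) = e * x"
  by (simp add: idem flip: mult.assoc)

lemma idem_mem: "e \<in> R 1 1"
  by (simp add: peirce_space_iff idem)

lemma peirce_mem: "peirce e i a j \<in> R i j"
  by (rule peirce_mem_peirce_space) (rule idem)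

lemma peirce_decomp: "a = peirce e 1 a 1 + peirce e 1 a 2 + peirce e 2 a 1 + peirce e 2 a 2"
  by (simp add: peirce_def lmul_def rmul_def algebra_simps)

lemma peirce_cases:
  obtains a11 a12 a21 a22
  where "a11 \<in> R 1 1" "a12 \<in> R 1 2" "a21 \<in> R 2 1" "a22 \<in> R 2 2" "a = a11 + a12 + a21 + a22"
  using peirce_decomp[of a] peirce_mem by metis

text \<open>Since \<open>a\<close> absorbs \<open>e\<^sub>j\<close> on the right, only the component
  \<open>e\<^sub>j r e\<^sub>k\<close> of \<open>r\<close> contributes to
  \<open>a r e\<^sub>k\<close>.\<close>

lemma peirce_right_eq_0:
  assumes "i \<in> {1,2}" "j \<in> {1,2}" "k \<in> {1,2}" "a \<in> R i j" "\<And>s. s \<in> R j k \<Longrightarrow> a * s = 0"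
  shows "a = 0"
proof (rule peirce_right[OF assms(1-4)])
  fix r
  have "rmul e (a * r) k = rmul e (rmul e a j * r) k"
    using assms(4) by (simp add: peirce_space_def)
  also have "\<dots> = a * peirce e j r k"
    by (simp add: rmul_lmul_middle rmul_mult peirce_def)
  also have "\<dots> = 0"
    using assms(2,3,5) peirce_mem by blast
  finally show "rmul e (a * r) k = 0" .
qed

lemma peirce_left_eq_0:
  assumes "i \<in> {1,2}" "j \<in> {1,2}" "k \<in> {1,2}" "a \<in> R i j" "\<And>s. s \<in> R k i \<Longrightarrow> s * a = 0"
  shows "a = 0"
proof (rule peirce_left[OF assms(1-4)])
  fix r
  have "lmul e k (r * a) = lmul e k (r * lmul e i a)"
    using assms(4) by (simp add: peirce_space_def)
  also have "\<dots> = peirce e k r i * a"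
    by (simp add: rmul_lmul_middle[symmetric] lmul_mult peirce_assoc)
  also have "\<dots> = 0"
    using assms(1,3,5) peirce_mem by blast
  finally show "lmul e k (r * a) = 0" .
qed

text \<open>Multiplying \<open>de + ed = 0\<close> by \<open>e\<close> on either side gives
  \<open>ed = -ede = de\<close>; then \<open>2de = 0\<close>, and torsion-freeness applies.\<close>

lemma jordan_idem_eq_0:
  assumes "d \<odot> e = 0"
  shows "d \<in> R 2 2"
proof -
  have *: "d * e + e * d = 0"
    using assms by (simp add: jordan_def)
  have "e * (d * e + e * d) = 0" "(d * e + e * d) * e = 0"
    by (simp_all add: *)
  then have 1: "e * (d * e) + e * d = 0" "d * e + e * (d * e) = 0"
    by (simp_all add: distrib_left distrib_right mult.assoc idem idem_left)
  then have 2: "e * d = d * e"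
    by (metis add.commute eq_neg_iff_add_eq_0)
  with * have "d * e + d * e = 0"
    by simp
  then have "d * e = 0"
    by (rule torsion_free)
  with 2 show ?thesis
    by (simp add: peirce_space_iff)
qed

text \<open>The surviving parts of \<open>d \<odot> s\<close> lie in three different Peirce spaces,
  so they vanish separately. Condition (i) then removes \<open>a12\<close> and \<open>a21\<close>,
  and condition (ii) removes \<open>a22\<close>.\<close>

lemma jordan_R22_eq_0:
  assumes "\<And>s. s \<in> R 2 2 \<Longrightarrow> d \<odot> s = 0"
  shows "d \<in> R 1 1"
proof (cases d rule: peirce_cases)
  case (1 a11 a12 a21 a22)
  have *: "a12 * s = 0 \<and> s * a21 = 0 \<and> a22 \<odot> s = 0" if s: "s \<in> R 2 2" for s
  proof -
    have z: "a11 * s = 0" "s * a11 = 0" "a21 * s = 0" "s * a12 = 0"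
      using peirce_space_mult_eq_0[OF 1(1) s] peirce_space_mult_eq_0[OF s 1(1)]
        peirce_space_mult_eq_0[OF 1(3) s] peirce_space_mult_eq_0[OF s 1(2)] by simp_all
    have eq: "a12 * s + s * a21 + a22 \<odot> s = 0"
      using assms[OF s] z unfolding 1(5) by (simp add: jordan_def algebra_simps)
    have m: "a12 * s \<in> R 1 2" "s * a21 \<in> R 2 1" "a22 \<odot> s \<in> R 2 2"
      using peirce_space_mult[OF 1(2) s] peirce_space_mult[OF s 1(3)]
        peirce_space_mult[OF 1(4) s] peirce_space_mult[OF s 1(4)]
      by (simp_all add: jordan_def peirce_space_add)
    \<comment> \<open>Multiplication by \<open>e\<close> on the left isolates the part in
      \<open>R 1 2\<close>, on the right the part in \<open>R 2 1\<close>.\<close>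
    have "e * (a12 * s + s * a21 + a22 \<odot> s) = a12 * s" "(a12 * s + s * a21 + a22 \<odot> s) * e = s * a21"
      using m[unfolded peirce_space_iff] by (simp_all only: distrib_left distrib_right) simp_all
    with eq show ?thesis
      by simp
  qed
  have "a12 = 0"
    by (rule peirce_right_eq_0[of 1 2 2]) (simp_all add: * 1)
  moreover have "a21 = 0"
    by (rule peirce_left_eq_0[of 2 1 2]) (simp_all add: * 1)
  moreover have "a22 = 0"
    by (rule jordan_22) (simp_all add: * 1)
  ultimately show ?thesis
    using 1 by simp
qed

text \<open>The multipliers in \<open>R 2 2\<close> confine \<open>d\<close> to
  \<open>R 1 1\<close>, where \<open>d \<odot> s\<close> is the one-sided product
  \<open>d * s\<close>, so (i) applies. In the two variants with \<open>e\<close>, that single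
  multiplier confines \<open>d\<close> to \<open>R 2 2\<close>.\<close>

lemma jordan_eq_0_R22_R12:
  assumes "\<And>s. s \<in> R 2 2 \<Longrightarrow> d \<odot> s = 0" "\<And>s. s \<in> R 1 2 \<Longrightarrow> d \<odot> s = 0"
  shows "d = 0"
proof (rule peirce_right_eq_0[of 1 1 2])
  show d: "d \<in> R 1 1"
    by (rule jordan_R22_eq_0) (rule assms)
  show "d * s = 0" if "s \<in> R 1 2" for s
    using assms(2)[OF that] peirce_space_mult_eq_0[OF that d] by (simp add: jordan_def)
qed simp_all

lemma jordan_eq_0_R22_R21:
  assumes "\<And>s. s \<in> R 2 2 \<Longrightarrow> d \<odot> s = 0" "\<And>s. s \<in> R 2 1 \<Longrightarrow> d \<odot> s = 0"
  shows "d = 0"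
proof (rule peirce_left_eq_0[of 1 1 2])
  show d: "d \<in> R 1 1"
    by (rule jordan_R22_eq_0) (rule assms)
  show "s * d = 0" if "s \<in> R 2 1" for s
    using assms(2)[OF that] peirce_space_mult_eq_0[OF d that] by (simp add: jordan_def)
qed simp_all

lemma jordan_eq_0_idem_R12:
  assumes "d \<odot> e = 0" "\<And>s. s \<in> R 1 2 \<Longrightarrow> d \<odot> s = 0"
  shows "d = 0"
proof (rule peirce_left_eq_0[of 2 2 1])
  show d: "d \<in> R 2 2"
    by (rule jordan_idem_eq_0) (rule assms)
  show "s * d = 0" if "s \<in> R 1 2" for s
    using assms(2)[OF that] peirce_space_mult_eq_0[OF d that] by (simp add: jordan_def)
qed simp_all

lemma jordan_eq_0_idem_R21:
  assumes "d \<odot> e = 0" "\<And>s. s \<in> R 2 1 \<Longrightarrow> d \<odot> s = 0"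
  shows "d = 0"
proof (rule peirce_right_eq_0[of 2 2 1])
  show d: "d \<in> R 2 2"
    by (rule jordan_idem_eq_0) (rule assms)
  show "d * s = 0" if "s \<in> R 2 1" for s
    using assms(2)[OF that] peirce_space_mult_eq_0[OF that d] by (simp add: jordan_def)
qed simp_all

lemma jordan_eq_0:
  fixes d :: 'r
  assumes "\<And>s. d \<odot> s = 0"
  shows "d = 0"
  by (rule jordan_eq_0_idem_R12) (rule assms)+

lemma jordan_left_cancel:
  fixes a b :: 'r
  assumes "\<And>s. a \<odot> s = b \<odot> s"
  shows "a = b"
  using jordan_eq_0[of "a - b"] assms by (simp add: jordan_diff_left)

lemma jordan_R_eq_0:
  "a \<in> R 1 1 \<Longrightarrow> b \<in> R 2 2 \<Longrightarrow> a \<odot> b = 0"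
  "a \<in> R 2 2 \<Longrightarrow> b \<in> R 1 1 \<Longrightarrow> a \<odot> b = 0"
  "a \<in> R 1 2 \<Longrightarrow> b \<in> R 1 2 \<Longrightarrow> a \<odot> b = 0"
  "a \<in> R 2 1 \<Longrightarrow> b \<in> R 2 1 \<Longrightarrow> a \<odot> b = 0"
  by (simp_all add: jordan_def peirce_space_mult_eq_0)

lemma jordan_R_mult:
  "a \<in> R 1 1 \<Longrightarrow> b \<in> R 1 2 \<Longrightarrow> a \<odot> b = a * b"
  "a \<in> R 2 2 \<Longrightarrow> b \<in> R 1 2 \<Longrightarrow> a \<odot> b = b * a"
  "a \<in> R 1 1 \<Longrightarrow> b \<in> R 2 1 \<Longrightarrow> a \<odot> b = b * a"
  "a \<in> R 2 2 \<Longrightarrow> b \<in> R 2 1 \<Longrightarrow> a \<odot> b = a * b"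
  "a \<in> R 1 2 \<Longrightarrow> b \<in> R 2 2 \<Longrightarrow> a \<odot> b = a * b"
  "a \<in> R 2 1 \<Longrightarrow> b \<in> R 2 2 \<Longrightarrow> a \<odot> b = b * a"
  by (simp_all add: jordan_def peirce_space_mult_eq_0)

lemma jordan_R_mem:
  "a \<in> R 1 1 \<Longrightarrow> b \<in> R 1 2 \<Longrightarrow> a \<odot> b \<in> R 1 2"
  "a \<in> R 2 2 \<Longrightarrow> b \<in> R 1 2 \<Longrightarrow> a \<odot> b \<in> R 1 2"
  "a \<in> R 1 1 \<Longrightarrow> b \<in> R 2 1 \<Longrightarrow> a \<odot> b \<in> R 2 1"
  "a \<in> R 1 2 \<Longrightarrow> b \<in> R 2 2 \<Longrightarrow> a \<odot> b \<in> R 1 2"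
  "a \<in> R 2 1 \<Longrightarrow> b \<in> R 2 2 \<Longrightarrow> a \<odot> b \<in> R 2 1"
  by (simp_all add: jordan_R_mult peirce_space_mult)

lemma jordan_idem:
  "a \<in> R 1 2 \<Longrightarrow> a \<odot> e = a"
  "a \<in> R 2 1 \<Longrightarrow> a \<odot> e = a"
  "a \<in> R 2 2 \<Longrightarrow> a \<odot> e = 0"
  "a \<in> R 1 2 \<Longrightarrow> e \<odot> a = a"
  "a \<in> R 2 1 \<Longrightarrow> e \<odot> a = a"
  "a \<in> R 2 2 \<Longrightarrow> e \<odot> a = 0"
  by (auto simp: jordan_def peirce_space_iff)

lemma jordan_idem_R11: "a \<in> R 1 1 \<Longrightarrow> a \<odot> e \<in> R 1 1"
  using idem by (simp add: jordan_def peirce_space_iff mult.assoc distrib_left distrib_right)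

end

section \<open>The symmetric pair of maps and the reduction principle\<close>

locale jordan_pair = peirce_ring e for e :: "'r::ring" +
  fixes P Q :: "'r \<Rightarrow> 's::ring"
  assumes bij_P: "bij P"
    and bij_Q: "bij Q"
    and P_jordan: "P (a \<odot> b) = P a \<odot> Q b"
    and Q_jordan: "Q (a \<odot> b) = P a \<odot> Q b"
begin

text \<open>Every result on \<open>P\<close> thereby holds for \<open>Q\<close> too, so a product
  \<open>P a \<odot> Q b\<close> can be expanded in both factors.\<close>

lemma swap: "jordan_pair e Q P"
proof unfold_locales
  show "Q (a \<odot> b) = Q a \<odot> P b" "P (a \<odot> b) = Q a \<odot> P b" for a b
    using P_jordan[of b a] Q_jordan[of b a] by (simp_all add: jordan_commute)
qed (fact bij_P bij_Q)+

lemma P_zero: "P 0 = 0"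
proof -
  obtain a where "Q a = 0"
    using surjD[OF bij_is_surj[OF bij_Q], of 0] by metis
  then show ?thesis
    using P_jordan[of 0 a] by simp
qed

lemma jordan_diff_sum_eq_0:
  assumes "P c = P a + P b" "P ((a + b) \<odot> s) = P (a \<odot> s) + P (b \<odot> s)"
  shows "(c - (a + b)) \<odot> s = 0"
proof -
  have "P (c \<odot> s) = P ((a + b) \<odot> s)"
    using assms by (simp add: P_jordan jordan_add_left)
  then have "c \<odot> s = (a + b) \<odot> s"
    by (simp add: inj_eq[OF bij_is_inj[OF bij_P]])
  then show ?thesis
    by (simp add: jordan_diff_left)
qed

lemma add_preimage: obtains c where "P c = P a + P b"
  using surjD[OF bij_is_surj[OF bij_P], of "P a + P b"] by metis

text \<open>The principle for one annihilating set: additivity at \<open>a\<close>, \<open>b\<close>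
  is reduced to additivity at \<open>a \<odot> s\<close>, \<open>b \<odot> s\<close>. The next three
  lemmas use the other sets.\<close>

lemma P_add_R22_R12:
  assumes "\<And>s. s \<in> R 2 2 \<Longrightarrow> P ((a + b) \<odot> s) = P (a \<odot> s) + P (b \<odot> s)"
    and "\<And>s. s \<in> R 1 2 \<Longrightarrow> P ((a + b) \<odot> s) = P (a \<odot> s) + P (b \<odot> s)"
  shows "P (a + b) = P a + P b"
proof -
  obtain c where c: "P c = P a + P b" by (rule add_preimage)
  have "c - (a + b) = 0"
    by (rule jordan_eq_0_R22_R12) (auto intro: jordan_diff_sum_eq_0[OF c] assms)
  then show ?thesis using c by simp
qed

lemma P_add_R22_R21:
  assumes "\<And>s. s \<in> R 2 2 \<Longrightarrow> P ((a + b) \<odot> s) = P (a \<odot> s) + P (b \<odot> s)"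
    and "\<And>s. s \<in> R 2 1 \<Longrightarrow> P ((a + b) \<odot> s) = P (a \<odot> s) + P (b \<odot> s)"
  shows "P (a + b) = P a + P b"
proof -
  obtain c where c: "P c = P a + P b" by (rule add_preimage)
  have "c - (a + b) = 0"
    by (rule jordan_eq_0_R22_R21) (auto intro: jordan_diff_sum_eq_0[OF c] assms)
  then show ?thesis using c by simp
qed

lemma P_add_idem_R12:
  assumes "P ((a + b) \<odot> e) = P (a \<odot> e) + P (b \<odot> e)"
    and "\<And>s. s \<in> R 1 2 \<Longrightarrow> P ((a + b) \<odot> s) = P (a \<odot> s) + P (b \<odot> s)"
  shows "P (a + b) = P a + P b"
proof -
  obtain c where c: "P c = P a + P b" by (rule add_preimage)
  have "c - (a + b) = 0"
    by (rule jordan_eq_0_idem_R12) (auto intro: jordan_diff_sum_eq_0[OF c] assms)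
  then show ?thesis using c by simp
qed

lemma P_add_idem_R21:
  assumes "P ((a + b) \<odot> e) = P (a \<odot> e) + P (b \<odot> e)"
    and "\<And>s. s \<in> R 2 1 \<Longrightarrow> P ((a + b) \<odot> s) = P (a \<odot> s) + P (b \<odot> s)"
  shows "P (a + b) = P a + P b"
proof -
  obtain c where c: "P c = P a + P b" by (rule add_preimage)
  have "c - (a + b) = 0"
    by (rule jordan_eq_0_idem_R21) (auto intro: jordan_diff_sum_eq_0[OF c] assms)
  then show ?thesis using c by simp
qed

section \<open>Sums of two Peirce components\<close>

text \<open>Here and in the next three lemmas the multipliers are chosen so that each annihilates
  one of the summands, which leaves only \<open>P 0 = 0\<close>.\<close>

lemma P_add_11_12: "a \<in> R 1 1 \<Longrightarrow> b \<in> R 1 2 \<Longrightarrow> P (a + b) = P a + P b"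
  by (rule P_add_R22_R12) (simp_all add: jordan_add_left jordan_R_eq_0 P_zero)

lemma P_add_11_21: "a \<in> R 1 1 \<Longrightarrow> b \<in> R 2 1 \<Longrightarrow> P (a + b) = P a + P b"
  by (rule P_add_R22_R21) (simp_all add: jordan_add_left jordan_R_eq_0 P_zero)

lemma P_add_22_12: "a \<in> R 2 2 \<Longrightarrow> b \<in> R 1 2 \<Longrightarrow> P (a + b) = P a + P b"
  by (rule P_add_idem_R12) (simp_all add: jordan_add_left jordan_R_eq_0 jordan_idem P_zero)

lemma P_add_22_21: "a \<in> R 2 2 \<Longrightarrow> b \<in> R 2 1 \<Longrightarrow> P (a + b) = P a + P b"
  by (rule P_add_idem_R21) (simp_all add: jordan_add_left jordan_R_eq_0 jordan_idem P_zero)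

text \<open>
  For \<open>t\<close> in \<open>R\<^sub>2\<^sub>2\<close> the element \<open>(a + b)t\<close> of \<open>R\<^sub>1\<^sub>2\<close> equals \<open>(e + a) \<odot> (t + bt)\<close>, and both
  factors are sums that \<open>P\<close> and \<open>Q\<close> are already known to respect.
\<close>

lemma P_add_12:
  assumes a: "a \<in> R 1 2" and b: "b \<in> R 1 2"
  shows "P (a + b) = P a + P b"
proof (rule P_add_R22_R12)
  fix t assume t: "t \<in> R 2 2"
  have bt: "b \<odot> t \<in> R 1 2"
    using b t by (rule jordan_R_mem)
  have eq: "e \<odot> t = 0" "e \<odot> (b \<odot> t) = b \<odot> t" "a \<odot> (b \<odot> t) = 0"
    using a t bt by (simp_all add: jordan_idem jordan_R_eq_0)
  have "P ((a + b) \<odot> t) = P ((e + a) \<odot> (t + b \<odot> t))"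
    by (simp add: jordan_add_left jordan_add_right eq add.commute)
  also have "\<dots> = (P e + P a) \<odot> (Q t + Q (b \<odot> t))"
    using P_add_11_12[OF idem_mem a] jordan_pair.P_add_22_12[OF swap t bt]
    by (simp add: P_jordan)
  also have "\<dots> = P (e \<odot> t) + P (e \<odot> (b \<odot> t)) + P (a \<odot> t) + P (a \<odot> (b \<odot> t))"
    by (simp add: P_jordan jordan_add_left jordan_add_right add_ac)
  also have "\<dots> = P (a \<odot> t) + P (b \<odot> t)"
    by (simp add: eq P_zero add.commute)
  finally show "P ((a + b) \<odot> t) = P (a \<odot> t) + P (b \<odot> t)" .
next
  fix s assume "s \<in> R 1 2"
  then show "P ((a + b) \<odot> s) = P (a \<odot> s) + P (b \<odot> s)"
    using a b by (simp add: jordan_add_left jordan_R_eq_0 P_zero)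
qed

text \<open>Mirror image of \<open>P_add_12\<close>: here \<open>(a + b) \<odot> t\<close> is
  \<open>t(a + b)\<close>, with the factors \<open>e + a\<close> and \<open>t + tb\<close>.\<close>

lemma P_add_21:
  assumes a: "a \<in> R 2 1" and b: "b \<in> R 2 1"
  shows "P (a + b) = P a + P b"
proof (rule P_add_R22_R21)
  fix t assume t: "t \<in> R 2 2"
  have bt: "b \<odot> t \<in> R 2 1"
    using b t by (rule jordan_R_mem)
  have eq: "e \<odot> t = 0" "e \<odot> (b \<odot> t) = b \<odot> t" "a \<odot> (b \<odot> t) = 0"
    using a t bt by (simp_all add: jordan_idem jordan_R_eq_0)
  have "P ((a + b) \<odot> t) = P ((e + a) \<odot> (t + b \<odot> t))"
    by (simp add: jordan_add_left jordan_add_right eq add.commute)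
  also have "\<dots> = (P e + P a) \<odot> (Q t + Q (b \<odot> t))"
    using P_add_11_21[OF idem_mem a] jordan_pair.P_add_22_21[OF swap t bt]
    by (simp add: P_jordan)
  also have "\<dots> = P (e \<odot> t) + P (e \<odot> (b \<odot> t)) + P (a \<odot> t) + P (a \<odot> (b \<odot> t))"
    by (simp add: P_jordan jordan_add_left jordan_add_right add_ac)
  also have "\<dots> = P (a \<odot> t) + P (b \<odot> t)"
    by (simp add: eq P_zero add.commute)
  finally show "P ((a + b) \<odot> t) = P (a \<odot> t) + P (b \<odot> t)" .
next
  fix s assume "s \<in> R 2 1"
  then show "P ((a + b) \<odot> s) = P (a \<odot> s) + P (b \<odot> s)"
    using a b by (simp add: jordan_add_left jordan_R_eq_0 P_zero)
qed

text \<open>In this and the next two lemmas multipliers from \<open>R 1 2\<close> carry both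
  summands into \<open>R 1 2\<close>, where \<open>P_add_12\<close> applies; the other multipliers
  annihilate at least one summand.\<close>

lemma P_add_11: "a \<in> R 1 1 \<Longrightarrow> b \<in> R 1 1 \<Longrightarrow> P (a + b) = P a + P b"
  by (rule P_add_R22_R12)
    (simp_all add: jordan_add_left jordan_R_eq_0 P_zero P_add_12 jordan_R_mem)

lemma P_add_22: "a \<in> R 2 2 \<Longrightarrow> b \<in> R 2 2 \<Longrightarrow> P (a + b) = P a + P b"
  by (rule P_add_idem_R12)
    (simp_all add: jordan_add_left jordan_idem P_zero P_add_12 jordan_R_mem)

lemma P_add_11_22: "a \<in> R 1 1 \<Longrightarrow> b \<in> R 2 2 \<Longrightarrow> P (a + b) = P a + P b"
  by (rule P_add_idem_R12)
    (simp_all add: jordan_add_left jordan_idem P_zero P_add_12 jordan_R_mem)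

text \<open>
  Here no set of multipliers \<open>s\<close> reduces to sums already treated. Instead \<open>P c = P a + P b\<close> forces
  \<open>c \<odot> e = c\<close>, which kills the diagonal components of \<open>c\<close>.
\<close>

lemma P_add_12_21:
  assumes a: "a \<in> R 1 2" and b: "b \<in> R 2 1"
  shows "P (a + b) = P a + P b"
proof -
  obtain c where c: "P c = P a + P b" by (rule add_preimage)
  have "P (c \<odot> e) = P (a \<odot> e) + P (b \<odot> e)"
    using c by (simp add: P_jordan jordan_add_left)
  then have "P (c \<odot> e) = P c"
    using a b c by (simp add: jordan_idem)
  then have ce: "c \<odot> e = c"
    by (simp add: inj_eq[OF bij_is_inj[OF bij_P]])
  \<comment> \<open>A multiplier from either space annihilates the summand lying in the same
    space.\<close>
  have 12: "(c - (a + b)) \<odot> s = 0" if "s \<in> R 1 2 \<or> s \<in> R 2 1" for s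
    by (rule jordan_diff_sum_eq_0[OF c])
      (use that a b in \<open>auto simp: jordan_add_left jordan_R_eq_0 P_zero\<close>)
  have ece: "e * c * e = 0"
  proof -
    have "e * (c \<odot> e) * e = e * c * e + e * c * e"
      by (simp add: jordan_def algebra_simps idem idem_left)
    then show ?thesis
      by (simp add: ce)
  qed
  obtain d11 d12 d21 d22 where d: "d11 \<in> R 1 1" "d12 \<in> R 1 2" "d21 \<in> R 2 1" "d22 \<in> R 2 2"
    "c - (a + b) = d11 + d12 + d21 + d22"
    by (rule peirce_cases)
  have "(c - (a + b)) \<odot> e = c - (a + b)"
    using a b by (simp add: ce jordan_diff_left jordan_add_left jordan_idem)
  then have "d11 \<odot> e + d12 + d21 = d11 + d12 + d21 + d22"
    using d by (simp add: jordan_add_left jordan_idem)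
  \<comment> \<open>\<open>d11 \<odot> e\<close> is \<open>d11 + d11\<close>. After cancelling, the
    common value lies in \<open>R 1 1\<close> and in \<open>R 2 2\<close>, hence is 0.\<close>
  then have "d11 = d22"
    using d(1) by (simp add: jordan_def peirce_space_iff algebra_simps)
  then have d0: "d11 = 0" "d22 = 0"
    using d(1,4) by (auto simp: peirce_space_iff)
  have m: "d12 \<odot> s = 0" if s: "s \<in> R 2 1" for s
    using 12[of s] d s by (simp add: d0 jordan_add_left jordan_R_eq_0)
  have n: "d21 \<odot> s = 0" if s: "s \<in> R 1 2" for s
    using 12[of s] d s by (simp add: d0 jordan_add_left jordan_R_eq_0)
  have "d12 = 0"
  proof (rule peirce_right_eq_0[of 1 2 1])
    fix s assume s: "s \<in> R 2 1"
    \<comment> \<open>\<open>d12 * s\<close> lies in \<open>R 1 1\<close> and \<open>s * d12\<close>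
      in \<open>R 2 2\<close>, so left multiplication by \<open>e\<close> keeps only the
      former.\<close>
    have "e * (d12 \<odot> s) = d12 * s"
      using d(2) s by (simp add: jordan_def peirce_space_iff distrib_left flip: mult.assoc)
    then show "d12 * s = 0" by (simp add: m[OF s])
  qed (use d in auto)
  moreover have "d21 = 0"
  proof (rule peirce_left_eq_0[of 2 1 1])
    fix s assume s: "s \<in> R 1 2"
    have "e * (d21 \<odot> s) = s * d21"
      using d(3) s by (simp add: jordan_def peirce_space_iff distrib_left flip: mult.assoc)
    then show "s * d21 = 0" by (simp add: n[OF s])
  qed (use d in auto)
  ultimately have "c = a + b"
    using d(5) d0 by simp
  then show ?thesis using c by simp
qed

section \<open>Sums of three and four components, and full additivity\<close>

lemma P_add_11_12_22:
  assumes "a \<in> R 1 1" "b \<in> R 1 2" "c \<in> R 2 2"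
  shows "P (a + b + c) = P a + P b + P c"
proof -
  have "P (a + b + c) = P (a + b) + P c"
    by (rule P_add_idem_R12)
      (use assms in \<open>simp_all add: jordan_add_left jordan_idem jordan_R_eq_0 P_zero P_add_12
        jordan_R_mem\<close>)
  then show ?thesis
    using assms by (simp add: P_add_11_12)
qed

text \<open>A multiplier from \<open>R 1 2\<close> turns an element of \<open>R 2 1\<close> into a
  diagonal sum \<open>s * b + b * s\<close>. This sum is split, the three-component case applied,
  and the diagonal part reassembled.\<close>

lemma P_add_12_jordan_12_21:
  assumes "a \<in> R 1 2" "b \<in> R 2 1" "s \<in> R 1 2"
  shows "P (a + b \<odot> s) = P a + P (b \<odot> s)"
proof -
  have m: "s * b \<in> R 1 1" "b * s \<in> R 2 2"
    using assms by (auto intro: peirce_space_mult)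
  have "a + b \<odot> s = s * b + a + b * s"
    by (simp add: jordan_def add_ac)
  then have "P (a + b \<odot> s) = P (s * b) + P a + P (b * s)"
    by (simp only: P_add_11_12_22[OF m(1) assms(1) m(2)])
  also have "P (s * b) + P a + P (b * s) = P a + P (s * b + b * s)"
    unfolding P_add_11_22[OF m] by (simp add: add_ac)
  finally show ?thesis
    by (simp add: jordan_def add.commute)
qed

text \<open>Multipliers from \<open>R 2 2\<close> annihilate \<open>a\<close> and leave a sum over
  \<open>R 1 2\<close> and \<open>R 2 1\<close>; those from \<open>R 1 2\<close> annihilate
  \<open>b\<close> and leave the sum treated just before.\<close>

lemma P_add_11_12_21:
  assumes "a \<in> R 1 1" "b \<in> R 1 2" "c \<in> R 2 1"
  shows "P (a + b + c) = P a + P b + P c"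
proof -
  have "P (a + b + c) = P (a + b) + P c"
    by (rule P_add_R22_R12)
      (use assms in \<open>simp_all add: jordan_add_left jordan_R_eq_0 P_add_12_21
        P_add_12_jordan_12_21 jordan_R_mem\<close>)
  then show ?thesis
    using assms by (simp add: P_add_11_12)
qed

lemma P_add_components:
  assumes "a \<in> R 1 1" "b \<in> R 1 2" "c \<in> R 2 1" "d \<in> R 2 2"
  shows "P (a + b + c + d) = P a + P b + P c + P d"
proof -
  have "P (a + b + c + d) = P (a + b + c) + P d"
  proof (rule P_add_idem_R12)
    show "P ((a + b + c + d) \<odot> e) = P ((a + b + c) \<odot> e) + P (d \<odot> e)"
      using assms by (simp add: jordan_add_left jordan_idem P_zero)
    fix s assume s: "s \<in> R 1 2"
    have m: "a \<odot> s \<in> R 1 2" "d \<odot> s \<in> R 1 2"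
      using assms s by (auto intro: jordan_R_mem)
    \<comment> \<open>The two terms in \<open>R 1 2\<close> are grouped against the diagonal term
      \<open>c \<odot> s\<close>; after splitting, only \<open>a \<odot> s\<close> is merged back
      with it.\<close>
    have "P ((a + b + c + d) \<odot> s) = P ((a \<odot> s + d \<odot> s) + c \<odot> s)"
      using assms s by (simp add: jordan_add_left jordan_R_eq_0 add_ac)
    also have "\<dots> = P (a \<odot> s) + P (d \<odot> s) + P (c \<odot> s)"
      using assms s m by (simp add: P_add_12_jordan_12_21 peirce_space_add P_add_12)
    also have "\<dots> = P (a \<odot> s + c \<odot> s) + P (d \<odot> s)"
      using assms s m by (simp add: P_add_12_jordan_12_21 add_ac)
    finally show "P ((a + b + c + d) \<odot> s) = P ((a + b + c) \<odot> s) + P (d \<odot> s)"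
      using assms s by (simp add: jordan_add_left jordan_R_eq_0)
  qed
  then show ?thesis
    using assms by (simp add: P_add_11_12_21)
qed

lemma P_add: "P (a + b) = P a + P b"
proof -
  obtain a11 a12 a21 a22 where a: "a11 \<in> R 1 1" "a12 \<in> R 1 2" "a21 \<in> R 2 1" "a22 \<in> R 2 2"
    "a = a11 + a12 + a21 + a22"
    by (rule peirce_cases)
  obtain b11 b12 b21 b22 where b: "b11 \<in> R 1 1" "b12 \<in> R 1 2" "b21 \<in> R 2 1" "b22 \<in> R 2 2"
    "b = b11 + b12 + b21 + b22"
    by (rule peirce_cases)
  have "P (a + b) = P ((a11 + b11) + (a12 + b12) + (a21 + b21) + (a22 + b22))"
    by (simp add: a(5) b(5) add_ac)
  also have "\<dots> = P (a11 + b11) + P (a12 + b12) + P (a21 + b21) + P (a22 + b22)"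
    using a b by (intro P_add_components peirce_space_add)
  also have "\<dots> = P a + P b"
    unfolding a(5) b(5) P_add_components[OF a(1-4)] P_add_components[OF b(1-4)]
    using a(1-4) b(1-4) by (simp add: P_add_11 P_add_12 P_add_21 P_add_22 add_ac)
  finally show ?thesis .
qed

end

section \<open>Bijectivity of the given maps and passage to the symmetric pair\<close>

theorem theorem2:
  fixes e :: "'r::ring"
    and M :: "'r \<Rightarrow> 's::ring"
    and Mstar :: "'s \<Rightarrow> 'r"
  assumes "two_torsion_free TYPE('r)"
    and "nontrivial_idempotent e"
    and "\<forall>a. \<forall>i\<in>{1,2}. \<forall>j\<in>{1,2}. \<forall>k\<in>{1,2}.
           range (\<lambda>r. rmul e (peirce e i a j * r) k) = {0} \<or>
           range (\<lambda>r. lmul e k (r * peirce e i a j)) = {0} \<longrightarrow>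
           peirce e i a j = 0"
    and "\<forall>a. (\<forall>b. rmul e (peirce e 2 a 2 * b) 2 + rmul e (peirce e 2 b 2 * a) 2 = 0) \<longrightarrow>
           peirce e 2 a 2 = 0"
    and "surj M"
    and "surj Mstar"
    and "\<forall>a x. M (a * Mstar x + Mstar x * a) = M a * x + x * M a"
    and "\<forall>a x. Mstar (M a * x + x * M a) = a * Mstar x + Mstar x * a"
  shows "additive M \<and> additive Mstar"
proof -
  have idem: "e * e = e"
    using assms(2) by (simp add: nontrivial_idempotent_def)
  have fix_peirce: "peirce e i a j = a" if "a \<in> peirce_space e i j" for a i j
    using that by (simp add: peirce_space_def peirce_def)
  interpret peirce_ring e
  proof
    show "a = 0" if "a + a = 0" for a :: 'r
      using assms(1) that unfolding two_torsion_free_def by blast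
    show "a = 0" if "i \<in> {1,2}" "j \<in> {1,2}" "k \<in> {1,2}" "a \<in> peirce_space e i j"
      "\<And>r. rmul e (a * r) k = 0" for i j k a
      using assms(3)[rule_format, OF that(1-3), of a] that(5) by (simp add: fix_peirce[OF that(4)])
    show "a = 0" if "i \<in> {1,2}" "j \<in> {1,2}" "k \<in> {1,2}" "a \<in> peirce_space e i j"
      "\<And>r. lmul e k (r * a) = 0" for i j k a
      using assms(3)[rule_format, OF that(1-3), of a] that(5) by (simp add: fix_peirce[OF that(4)])
    show "a = 0" if a: "a \<in> peirce_space e 2 2"
      and ann: "\<And>b. b \<in> peirce_space e 2 2 \<Longrightarrow> a \<odot> b = 0" for a
    proof -
      \<comment> \<open>For \<open>a\<close> in \<open>R 2 2\<close> this sum is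
        \<open>a \<odot> peirce e 2 b 2\<close>, so testing all \<open>b\<close> in (ii) amounts to
        testing \<open>R 2 2\<close>.\<close>
      have "rmul e (a * b) 2 + rmul e (peirce e 2 b 2 * a) 2 = 0" for b
      proof -
        have mem: "peirce e 2 b 2 \<in> peirce_space e 2 2"
          using idem by (rule peirce_mem_peirce_space)
        have ra: "rmul e a 2 = a"
          using a by (simp add: peirce_space_def)
        then have "rmul e (a * b) 2 = rmul e (rmul e a 2 * b) 2"
          by simp
        also have "\<dots> = a * peirce e 2 b 2"
          by (simp only: rmul_lmul_middle rmul_mult peirce_def)
        finally have "rmul e (a * b) 2 + rmul e (peirce e 2 b 2 * a) 2 = a \<odot> peirce e 2 b 2"
          by (simp only: rmul_mult ra jordan_def)
        then show ?thesis
          by (simp only: ann[OF mem])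
      qed
      then show ?thesis
        using assms(4)[rule_format, of a] by (simp add: fix_peirce[OF a])
    qed
  qed (fact idem)
  have M: "M (a \<odot> Mstar x) = M a \<odot> x" and Mstar: "Mstar (M a \<odot> x) = a \<odot> Mstar x" for a x
    using assms(7,8) by (simp_all add: jordan_def)
  \<comment> \<open>\<open>M a\<close> determines \<open>a \<odot> Mstar x\<close> for all
    \<open>x\<close>, and \<open>Mstar x\<close> runs through the whole ring, whose Jordan
    annihilator is trivial.\<close>
  have "inj M"
  proof (rule injI)
    fix a b assume "M a = M b"
    then have "a \<odot> Mstar x = b \<odot> Mstar x" for x
      by (metis Mstar)
    then show "a = b"
      using \<open>surj Mstar\<close> by (metis jordan_left_cancel surj_def)
  qed
  have "inj Mstar"
  proof (rule injI)
    fix x y assume "Mstar x = Mstar y"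
    then have xy: "M a \<odot> x = M a \<odot> y" for a
      by (metis M)
    \<comment> \<open>Cancellation is available only in the domain of \<open>M\<close>, so the
      comparison of \<open>x\<close> and \<open>y\<close> is pulled back to preimages under
      \<open>M\<close>.\<close>
    obtain p q where pq: "x = M p" "y = M q"
      using \<open>surj M\<close> by (metis surj_def)
    have "M (p \<odot> Mstar w) = M (q \<odot> Mstar w)" for w
      using \<open>surj M\<close> xy pq M jordan_commute by (metis surj_def)
    then have "p \<odot> Mstar w = q \<odot> Mstar w" for w
      using \<open>inj M\<close> by (simp add: inj_eq)
    then have "p = q"
      using \<open>surj Mstar\<close> by (metis jordan_left_cancel surj_def)
    then show "x = y" using pq by simp
  qed
  define Q where "Q = inv Mstar"
  have Q: "Mstar (Q r) = r" "Q (Mstar x) = x" for r x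
    using \<open>surj Mstar\<close> \<open>inj Mstar\<close> by (simp_all add: Q_def surj_f_inv_f)
  interpret jordan_pair e M Q
  proof
    show "bij M" "bij Q"
      using \<open>inj M\<close> \<open>surj M\<close> \<open>inj Mstar\<close> \<open>surj Mstar\<close>
      by (simp_all add: Q_def bij_def bij_imp_bij_inv inj_imp_surj_inv surj_imp_inj_inv)
    \<comment> \<open>The given identities at \<open>x = Q b\<close>, where
      \<open>Mstar x = b\<close>; the second follows by applying \<open>Q\<close>.\<close>
    show "M (a \<odot> b) = M a \<odot> Q b" "Q (a \<odot> b) = M a \<odot> Q b" for a b
      using M[of a "Q b"] Mstar[of a "Q b"] by (metis Q)+
  qed
  have "Q (a + b) = Q a + Q b" for a b
    by (rule jordan_pair.P_add[OF swap])
  \<comment> \<open>Additivity passes from \<open>Q\<close> to its inverse, by taking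
    \<open>a = Mstar x\<close> and \<open>b = Mstar y\<close>.\<close>
  then have "Mstar (x + y) = Mstar x + Mstar y" for x y
    by (metis Q)
  then show ?thesis
    by (simp add: additive_def P_add)
qed

end
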